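(* Let $n\geq 6$, let $W$ be the Coxeter group of type $E_n$ and let $\mathbf{W}$ be its flipping group. The following are orbits of $F_2^n$ under the action of $\mathbf{W}$: $$O_0=\{0\},$$ $$O_1=\{a\in F_2^n : a\neq 0,\ wt(a)\equiv 1 \text{ or } n-2 \pmod 4\},$$ $$O_2=\{a\in F_2^n : a\neq 0,\ wt(a)\equiv 2 \text{ or } n-3 \pmod 4\},$$ $$O_3=\{a\in F_2^n : a\neq 0,\ wt(a)\equiv 3 \text{ or } n \pmod 4\},$$ $$O_4=\{a\in F_2^n : a\neq 0,\ wt(a)\equiv 0 \text{ or } n-1 \pmod 4\}.$$ In particular $O_1=O_3$ when $n\equiv 1\pmod 4$; $O_1=O_4$ and $O_2=O_3$ when $n\equiv 2\pmod 4$; $O_2=O_4$ when $n\equiv 3\pmod 4$; and $O_1=O_2$ and $O_3=O_4$ when $n\equiv 0\pmod 4$.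
   Context: For $n\ge 6$ the Coxeter graph of type $E_n$ has vertex set $S=\{s_1,\dots,s_n\}$ and edge set $R=\{s_is_{i+1}: 1\le i\le n-2\}\cup\{s_{n-3}s_n\}$. The Coxeter group $W$ of type $E_n$ is generated by $S$ with relations $s^2=1$, $(ss')^3=1$ if $ss'\in R$, and $(ss')^2=1$ if $s\ne s'$, $ss'\notin R$. $F_2^n$ is the space of column vectors over the two-element field $F_2$ indexed by $S$, and $\widetilde{s}$ is the characteristic vector of $s\in S$. For $s\in S$, $\mathbf{s}$ is the $n\times n$ matrix over $F_2$ acting by $\mathbf{s}\widetilde{v}=\widetilde{v}$ for $v\ne s$ and $\mathbf{s}\widetilde{s}=\widetilde{s}+\sum_{us\in R}\widetilde{u}$. The flipping group $\mathbf{W}$ is the subgroup of $\mathrm{GL}_n(F_2)$ generated by $\mathbf{s}$, $s\in S$; it acts on $F_2^n$ by left multiplication. Put $\overline{1}=\widetilde{s}_1$ and $\overline{i+1}=\mathbf{s_i}\mathbf{s_{i-1}}\cdots\mathbf{s_1}\overline{1}$ for $1\le i\le n-1$; thus $\overline{i}=\widetilde{s}_{i-1}+\widetilde{s}_i$ for $2\le i\le n-3$, $\overline{n-2}=\widetilde{s}_{n-3}+\widetilde{s}_{n-2}+\widetilde{s}_n$, $\overline{n-1}=\widetilde{s}_{n-2}+\widetilde{s}_{n-1}+\widetilde{s}_n$, $\overline{n}=\widetilde{s}_{n-1}+\widetilde{s}_n$. The set $\Delta=\{\overline{1},\dots,\overline{n}\}$ is a basis of $F_2^n$. For $a\in F_2^n$,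 $wt(a)$ is the number of elements of $\Delta$ appearing in the expression of $a$ as a linear combination of elements of $\Delta$. *)

theory Defs
  imports
    "Jordan_Normal_Form.VS_Connect"
    "HOL-Algebra.Group_Action"
    "HOL-Algebra.Elementary_Groups"
    "HOL-Number_Theory.Cong"
    "HOL-Library.Z2"
begin

text \<open>The two-element field is the type \<open>bit\<close>. The vertex \<open>s\<^sub>i\<close> of the Coxeter graph of type
  \<open>E\<^sub>n\<close> is represented by its index \<open>i\<close>, with \<open>1 \<le> i \<le> n\<close>. Vectors and matrices are indexed from
  \<open>0\<close>, so the coordinate belonging to \<open>s\<^sub>i\<close> has position \<open>i - 1\<close>. All definitions are meant for
  \<open>n \<ge> 6\<close>, where the natural number subtractions below do not truncate.\<close>

definition E_vertices :: "nat \<Rightarrow> nat set" where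
  "E_vertices n = {1..n}"

definition E_edges :: "nat \<Rightarrow> nat set set" where
  "E_edges n = {{i, i + 1} | i. 1 \<le> i \<and> i \<le> n - 2} \<union> {{n - 3, n}}"

definition char_vec :: "nat \<Rightarrow> nat \<Rightarrow> bit vec" where
  "char_vec n s = unit_vec n (s - 1)"

text \<open>The columns of the matrix of a vertex \<open>s\<close> are the images of the characteristic vectors of
  the vertices.\<close>

definition flip_image :: "nat \<Rightarrow> nat \<Rightarrow> nat \<Rightarrow> bit vec" where
  "flip_image n s v =
    (if v = s
     then char_vec n s + finsum_vec TYPE(bit) n (char_vec n) {u \<in> E_vertices n. {u, s} \<in> E_edges n}
     else char_vec n v)"

definition flip_mat :: "nat \<Rightarrow> nat \<Rightarrow> bit mat" where
  "flip_mat n s = mat_of_cols n (map (flip_image n s) [1..<Suc n])"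

definition GL2 :: "nat \<Rightarrow> bit mat monoid" where
  "GL2 n = units_of (ring_mat TYPE(bit) n ())"

text \<open>The operator \<open>subgroup_generated\<close> intersects the generators with the carrier of the group;
  lemma \<open>flip_mat_in_GL2\<close> below shows that no generator is lost.\<close>

definition flipping_group :: "nat \<Rightarrow> bit mat monoid" where
  "flipping_group n = subgroup_generated (GL2 n) (flip_mat n ` E_vertices n)"

definition flipping_orbits :: "nat \<Rightarrow> bit vec set set" where
  "flipping_orbits n = Group_Action.orbits (flipping_group n) (carrier_vec n) (\<lambda>A v. A *\<^sub>v v)"

text \<open>\<open>delta_vec n i\<close> is \<open>s\<^sub>i\<^sub>-\<^sub>1 (\<dots> (s\<^sub>1 v))\<close> for the characteristic vector \<open>v\<close> of \<open>s\<^sub>1\<close>: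
  \<open>fold\<close> applies the matrix with index \<open>1\<close> first.\<close>

definition delta_vec :: "nat \<Rightarrow> nat \<Rightarrow> bit vec" where
  "delta_vec n i = fold (\<lambda>j v. flip_mat n j *\<^sub>v v) [1..<i] (char_vec n 1)"

definition Delta :: "nat \<Rightarrow> bit vec set" where
  "Delta n = delta_vec n ` {1..n}"

text \<open>Since \<open>Delta n\<close> is a basis, the coefficients of the expression of \<open>a\<close> are unique on
  \<open>Delta n\<close>, so that the weight does not depend on the choice made here.\<close>

definition Delta_coeff :: "nat \<Rightarrow> bit vec \<Rightarrow> bit vec \<Rightarrow> bit" where
  "Delta_coeff n a = (SOME c. module.lincomb (module_vec TYPE(bit) n) c (Delta n) = a)"

definition wt :: "nat \<Rightarrow> bit vec \<Rightarrow> nat" where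
  "wt n a = card {d \<in> Delta n. Delta_coeff n a d \<noteq> 0}"

definition O_0 :: "nat \<Rightarrow> bit vec set" where
  "O_0 n = {0\<^sub>v n}"

definition O_1 :: "nat \<Rightarrow> bit vec set" where
  "O_1 n = {a \<in> carrier_vec n. a \<noteq> 0\<^sub>v n \<and> ([wt n a = 1] (mod 4) \<or> [wt n a = n - 2] (mod 4))}"

definition O_2 :: "nat \<Rightarrow> bit vec set" where
  "O_2 n = {a \<in> carrier_vec n. a \<noteq> 0\<^sub>v n \<and> ([wt n a = 2] (mod 4) \<or> [wt n a = n - 3] (mod 4))}"

definition O_3 :: "nat \<Rightarrow> bit vec set" where
  "O_3 n = {a \<in> carrier_vec n. a \<noteq> 0\<^sub>v n \<and> ([wt n a = 3] (mod 4) \<or> [wt n a = n] (mod 4))}"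

definition O_4 :: "nat \<Rightarrow> bit vec set" where
  "O_4 n = {a \<in> carrier_vec n. a \<noteq> 0\<^sub>v n \<and> ([wt n a = 0] (mod 4) \<or> [wt n a = n - 1] (mod 4))}"

lemma char_vec_carrier [simp]: "char_vec n s \<in> carrier_vec n"
  by (simp add: char_vec_def)

lemma edge_sum_carrier [simp]:
  "finsum_vec TYPE(bit) n (char_vec n) S \<in> carrier_vec n"
  by (rule finsum_vec_closed) auto

lemma flip_image_carrier [simp]: "flip_image n s v \<in> carrier_vec n"
  by (simp add: flip_image_def)

lemma flip_mat_carrier [simp]: "flip_mat n s \<in> carrier_mat n n"
  unfolding flip_mat_def
  by (rule carrier_matI) (simp_all del: upt_Suc)

lemma flip_mat_dim [simp]: "dim_row (flip_mat n s) = n" "dim_col (flip_mat n s) = n"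
  using flip_mat_carrier[of n s] by (blast dest: carrier_matD)+

lemma flip_mat_char_vec:
  assumes "v \<in> E_vertices n"
  shows "flip_mat n s *\<^sub>v char_vec n v = flip_image n s v"
proof -
  have v: "v - 1 < n" "Suc (v - 1) = v" using assms by (auto simp: E_vertices_def)
  have "flip_mat n s *\<^sub>v char_vec n v = col (flip_mat n s) (v - 1)"
    unfolding char_vec_def using v by (intro eq_vecI) (auto simp: row_def)
  also have "\<dots> = map (flip_image n s) [1..<Suc n] ! (v - 1)"
    unfolding flip_mat_def using v by (intro col_mat_of_cols) (auto simp del: upt_Suc)
  also have "\<dots> = flip_image n s v" using v by (simp del: upt_Suc)
  finally show ?thesis .
qed

lemma edge_irrefl: "n \<ge> 6 \<Longrightarrow> {s, s} \<notin> E_edges n"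
  by (auto simp: E_edges_def)

lemma flip_mat_index:
  assumes "n \<ge> 6" "r < n" "c < n"
  shows "flip_mat n s $$ (r, c) =
    of_bool (r = c) + of_bool (Suc c = s \<and> {Suc r, s} \<in> E_edges n)"
proof -
  let ?S = "{u \<in> E_vertices n. {u, s} \<in> E_edges n}"
  have fin: "finite ?S" by (simp add: E_vertices_def)
  have sum: "finsum_vec TYPE(bit) n (char_vec n) ?S $ r = of_bool ({Suc r, s} \<in> E_edges n)"
  proof -
    have "finsum_vec TYPE(bit) n (char_vec n) ?S $ r = (\<Sum>u\<in>?S. char_vec n u $ r)"
      by (rule index_finsum_vec) (use fin assms in auto)
    also have "\<dots> = (\<Sum>u\<in>?S. if u = Suc r then 1 else 0)"
      by (rule sum.cong) (use assms in \<open>auto simp: char_vec_def unit_vec_def E_vertices_def\<close>)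
    also have "\<dots> = of_bool ({Suc r, s} \<in> E_edges n)"
      using fin assms by (auto simp: E_vertices_def)
    finally show ?thesis .
  qed
  have "flip_mat n s $$ (r, c) = flip_image n s (Suc c) $ r"
    using assms by (simp add: flip_mat_def mat_of_cols_index del: upt_Suc)
  also have "\<dots> = of_bool (r = c) + of_bool (Suc c = s \<and> {Suc r, s} \<in> E_edges n)"
  proof (cases "Suc c = s")
    case True
    then have "flip_image n s (Suc c) $ r = char_vec n (Suc c) $ r + finsum_vec TYPE(bit) n (char_vec n) ?S $ r"
      using assms(2) carrier_vecD[OF edge_sum_carrier, of n ?S]
      by (simp only: flip_image_def if_True refl index_add_vec)
    moreover have "char_vec n (Suc c) $ r = of_bool (r = c)"
      using assms by (simp add: char_vec_def)
    ultimately show ?thesis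
      unfolding sum using True by (simp only: simp_thms)
  next
    case False
    then show ?thesis using assms by (simp add: flip_image_def char_vec_def)
  qed
  finally show ?thesis .
qed

lemma flip_mat_involution:
  assumes "n \<ge> 6"
  shows "flip_mat n s * flip_mat n s = 1\<^sub>m n"
proof (rule eq_matI)
  fix r c assume "r < dim_row (1\<^sub>m n :: bit mat)" "c < dim_col (1\<^sub>m n :: bit mat)"
  then have rc: "r < n" "c < n" by auto
  define e where "e i = (of_bool ({Suc i, s} \<in> E_edges n) :: bit)" for i
  have idx: "flip_mat n s $$ (i, j) = of_bool (i = j) + of_bool (Suc j = s) * e i"
    if "i < n" "j < n" for i j
    using flip_mat_index[OF assms that] by (simp add: e_def)
  have es: "of_bool (Suc i = s) * e i = 0" for i
    using edge_irrefl[OF assms, of s] by (auto simp: e_def)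
  have "(flip_mat n s * flip_mat n s) $$ (r, c) =
      (\<Sum>k<n. flip_mat n s $$ (r, k) * flip_mat n s $$ (k, c))"
    using rc unfolding times_mat_def scalar_prod_def
    by (subst index_mat) (simp_all only: split_conv flip_mat_dim dim_col atLeast0LessThan,
      intro sum.cong, simp_all)
  also have "\<dots> = (\<Sum>k<n. (of_bool (r = k) + of_bool (Suc k = s) * e r) *
      (of_bool (k = c) + of_bool (Suc c = s) * e k))"
    by (intro sum.cong) (use rc in \<open>simp_all add: idx\<close>)
  also have "\<dots> = (\<Sum>k<n. (if k = r then of_bool (r = c) + of_bool (Suc c = s) * e r else 0) +
      (if k = c then of_bool (Suc c = s) * e r else 0))"
  proof (intro sum.cong refl)
    fix k
    have "(of_bool (r = k) + of_bool (Suc k = s) * e r) *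
        (of_bool (k = c) + of_bool (Suc c = s) * e k) =
      of_bool (r = k) * (of_bool (k = c) + of_bool (Suc c = s) * e k) +
      of_bool (k = c) * of_bool (Suc k = s) * e r +
      (of_bool (Suc k = s) * e k) * (of_bool (Suc c = s) * e r)"
      by (simp only: algebra_simps)
    then show "(of_bool (r = k) + of_bool (Suc k = s) * e r) *
        (of_bool (k = c) + of_bool (Suc c = s) * e k) =
      (if k = r then of_bool (r = c) + of_bool (Suc c = s) * e r else 0) +
      (if k = c then of_bool (Suc c = s) * e r else 0)"
      unfolding es by auto
  qed
  also have "\<dots> = of_bool (r = c) + (of_bool (Suc c = s) * e r + of_bool (Suc c = s) * e r)"
    using rc by (simp only: sum.distrib sum.delta finite_lessThan lessThan_iff if_True add.assoc)
  also have "\<dots> = 1\<^sub>m n $$ (r, c)"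
    using rc by simp
  finally show "(flip_mat n s * flip_mat n s) $$ (r, c) = 1\<^sub>m n $$ (r, c)" .
qed auto

lemma flip_mat_in_GL2:
  assumes "n \<ge> 6"
  shows "flip_mat n s \<in> carrier (GL2 n)"
  using flip_mat_involution[OF assms]
  by (auto simp: GL2_def units_of_def Units_def ring_mat_simps intro!: bexI[of _ "flip_mat n s"])

end

theory Submission
  imports Defs
begin

text \<open>Identify a vector with the set \<open>A\<close> of indices of the elements of \<open>Delta n\<close> in its
  expansion. For \<open>s < n\<close> the generator with index \<open>s\<close> applies the transposition of \<open>s\<close> and
  \<open>s + 1\<close> to \<open>A\<close>, so orbits depend only on \<open>w = card A\<close>. The generator with index \<open>n\<close>
  complements \<open>A\<close> inside \<open>{1..n-3}\<close> when \<open>A\<close> has an odd number \<open>j\<close> of elements among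
  \<open>n-2, n-1, n\<close>. It turns the weight \<open>w\<close> into \<open>n - 1 - w\<close> (\<open>j = 1\<close>) or \<open>n + 3 - w\<close>
  (\<open>j = 3\<close>), which agree modulo \<open>4\<close>. Hence the classes of \<open>w\<close> modulo \<open>4\<close> and modulo
  \<open>w \<mapsto> n - 1 - w\<close> are invariant, and composing the two moves connects \<open>w\<close> with \<open>w + 4\<close>.\<close>

section \<open>Coordinates of the basis vectors and of their sums\<close>

text \<open>Over the two-element field a linear combination is a subset sum. Summing coordinatewise
  keeps the calculations inside ordinary \<open>bit\<close> sums.\<close>

definition delta_comb :: "nat \<Rightarrow> nat set \<Rightarrow> bit vec" where
  "delta_comb n A = vec n (\<lambda>r. \<Sum>i\<in>A. delta_vec n i $ r)"

lemma delta_comb_carrier [simp]: "delta_comb n A \<in> carrier_vec n"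
  by (simp add: delta_comb_def)

lemma delta_comb_index: "r < n \<Longrightarrow> delta_comb n A $ r = (\<Sum>i\<in>A. delta_vec n i $ r)"
  by (simp add: delta_comb_def)

lemma delta_comb_empty [simp]: "delta_comb n {} = 0\<^sub>v n"
  by (auto simp: delta_comb_def)

lemma of_bool_add_bit: "of_bool P + of_bool Q = (of_bool (P \<noteq> Q) :: bit)"
  by (cases P; cases Q) simp_all

lemma E_edges_iff:
  "{a, b} \<in> E_edges n \<longleftrightarrow>
    b = a + 1 \<and> 1 \<le> a \<and> a \<le> n - 2 \<or> a = b + 1 \<and> 1 \<le> b \<and> b \<le> n - 2 \<or>
    a = n - 3 \<and> b = n \<or> a = n \<and> b = n - 3"
  unfolding E_edges_def by (auto simp: doubleton_eq_iff)

text \<open>Only column \<open>s - 1\<close> differs from the identity matrix, and its extra entries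
  sit at the neighbours of \<open>s\<close>.\<close>

lemma flip_mat_mult_index:
  assumes "n \<ge> 6" "v \<in> carrier_vec n" "r < n" "s \<in> {1..n}"
  shows "(flip_mat n s *\<^sub>v v) $ r = v $ r + of_bool ({Suc r, s} \<in> E_edges n) * v $ (s - 1)"
proof -
  have "(flip_mat n s *\<^sub>v v) $ r = (\<Sum>c<n. flip_mat n s $$ (r, c) * v $ c)"
    using assms by (simp add: scalar_prod_def lessThan_atLeast0)
  also have "\<dots> = (\<Sum>c<n. (if c = r then v $ c else 0) +
      (if c = s - 1 then of_bool ({Suc r, s} \<in> E_edges n) * v $ c else 0))"
    using assms by (intro sum.cong) (auto simp: flip_mat_index algebra_simps)
  also have "\<dots> = v $ r + of_bool ({Suc r, s} \<in> E_edges n) * v $ (s - 1)"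
  proof -
    have "s - 1 < n" using assms by auto
    then show ?thesis
      using \<open>r < n\<close> by (simp only: sum.distrib sum.delta finite_lessThan lessThan_iff if_True)
  qed
  finally show ?thesis .
qed

lemma delta_vec_carrier [simp]: "delta_vec n i \<in> carrier_vec n"
proof -
  have "fold (\<lambda>j v. flip_mat n j *\<^sub>v v) xs v \<in> carrier_vec n" if "v \<in> carrier_vec n" for xs v
    using that by (induction xs arbitrary: v) (auto simp: mult_mat_vec_carrier[OF flip_mat_carrier])
  then show ?thesis by (simp add: delta_vec_def)
qed

lemma delta_vec_Suc: "i \<ge> 1 \<Longrightarrow> delta_vec n (Suc i) = flip_mat n i *\<^sub>v delta_vec n i"
  by (simp add: delta_vec_def)

text \<open>The vector with index \<open>i\<close> has coordinate 1 at its own vertex, so matrix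
  \<open>i\<close> adds all neighbours of that vertex: the vertex \<open>i - 1\<close> cancels and
  the vertex \<open>i + 1\<close> enters. The branch edge brings in the vertex \<open>n\<close> when
  \<open>i = n - 3\<close>; it drops out of the third disjunct at index \<open>n\<close>, where
  \<open>i = Suc r\<close> covers it.\<close>

lemma delta_vec_index:
  assumes "n \<ge> 6" "1 \<le> i" "i \<le> n" "r < n"
  shows "delta_vec n i $ r =
    of_bool (i = Suc r \<or> i = r + 2 \<or> Suc r = n \<and> (i = n - 2 \<or> i = n - 1))"
  using assms(2,3,4)
proof (induction i arbitrary: r rule: dec_induct)
  case base
  then show ?case using assms(1) by (auto simp: delta_vec_def char_vec_def)
next
  case (step i)
  have "delta_vec n (Suc i) $ r =
      delta_vec n i $ r + of_bool ({Suc r, i} \<in> E_edges n) * delta_vec n i $ (i - 1)"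
    using step assms(1) by (simp add: delta_vec_Suc flip_mat_mult_index del: index_mult_mat_vec)
  also have "delta_vec n i $ (i - 1) = 1"
    using step assms(1) by auto
  also have "delta_vec n i $ r = of_bool (i = Suc r \<or> i = r + 2 \<or> Suc r = n \<and> (i = n - 2 \<or> i = n - 1))"
    using step by auto
  finally have "delta_vec n (Suc i) $ r =
    of_bool ((i = Suc r \<or> i = r + 2 \<or> Suc r = n \<and> (i = n - 2 \<or> i = n - 1)) \<noteq>
      ({Suc r, i} \<in> E_edges n))"
    by (simp only: mult_1_right of_bool_add_bit)
  also have "\<dots> = of_bool (Suc i = Suc r \<or> Suc i = r + 2 \<or> Suc r = n \<and> (Suc i = n - 2 \<or> Suc i = n - 1))"
  proof (rule arg_cong[of _ _ of_bool])
    \<comment> \<open>This substitution removes truncated subtraction. The coordinate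
      \<open>m + 5\<close> belongs to the branch vertex \<open>n\<close> and is treated
      separately.\<close>
    obtain m where m: "n = m + 6" using assms(1) by (metis le_add_diff_inverse2)
    have i: "i \<le> m + 5" "1 \<le> i" using step.hyps(1) step.prems m by auto
    show "((i = Suc r \<or> i = r + 2 \<or> Suc r = n \<and> (i = n - 2 \<or> i = n - 1)) \<noteq>
        ({Suc r, i} \<in> E_edges n)) \<longleftrightarrow>
      (Suc i = Suc r \<or> Suc i = r + 2 \<or> Suc r = n \<and> (Suc i = n - 2 \<or> Suc i = n - 1))"
    proof (cases "r = m + 5")
      case True
      show ?thesis
        unfolding E_edges_iff m True using i
        by (cases "i = m + 3"; cases "i = m + 4"; cases "i = m + 5"; simp)
    next
      case False
      then have r: "r < m + 5" using step.prems m by auto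
      consider "i = Suc r" | "i = r + 2" | "i = r" | "i \<noteq> Suc r" "i \<noteq> r + 2" "i \<noteq> r" by blast
      then show ?thesis
        unfolding E_edges_iff by cases (use i r in \<open>simp_all add: m\<close>)
    qed
  qed
  finally show ?case .
qed

lemma delta_comb_singleton [simp]: "delta_comb n {i} = delta_vec n i"
proof (rule eq_vecI)
  show "dim_vec (delta_comb n {i}) = dim_vec (delta_vec n i)"
    using carrier_vecD[OF delta_comb_carrier] carrier_vecD[OF delta_vec_carrier] by metis
next
  fix r assume "r < dim_vec (delta_vec n i)"
  then have "r < n" using carrier_vecD[OF delta_vec_carrier, of n i] by metis
  then show "delta_comb n {i} $ r = delta_vec n i $ r" by (simp only: delta_comb_index) simp
qed

text \<open>The common part is counted twice on the right and vanishes in characteristic 2.\<close>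

lemma sum_sym_diff_bit:
  fixes f :: "'a \<Rightarrow> bit"
  assumes "finite A" "finite B"
  shows "sum f (sym_diff A B) = sum f A + sum f B"
proof -
  have "sum f (sym_diff A B) = sum f (A - B) + sum f (B - A)"
    using assms by (intro sum.union_disjoint) auto
  moreover have "sum f A = sum f (A \<inter> B) + sum f (A - B)"
    "sum f B = sum f (A \<inter> B) + sum f (B - A)"
    using assms sum.Int_Diff[of A f B] sum.Int_Diff[of B f A] by (auto simp: Int_commute)
  ultimately show ?thesis
    by (cases "sum f (A \<inter> B)"; cases "sum f (A - B)"; cases "sum f (B - A)"; simp)
qed

text \<open>The sum telescopes, since consecutive basis vectors share one vertex. The bound on
  \<open>k\<close> keeps the branch vertex \<open>n\<close> out of every summand.\<close>

lemma delta_comb_initial_index: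
  assumes "n \<ge> 6" "k \<le> n - 3" "r < n"
  shows "delta_comb n {1..k} $ r = of_bool (Suc r = k)"
  using assms(2)
proof (induction k)
  case 0
  then show ?case using assms by simp
next
  case (Suc k)
  have "delta_comb n {1..Suc k} $ r = delta_comb n {1..k} $ r + delta_vec n (Suc k) $ r"
    using assms by (simp add: delta_comb_index)
  also have "\<dots> = of_bool (Suc r = k) + delta_vec n (Suc k) $ r"
    using Suc by simp
  also have "\<dots> = of_bool (Suc r = Suc k)"
  proof -
    have "delta_vec n (Suc k) $ r = of_bool (k = r \<or> k = Suc r)"
      using Suc.prems assms by (subst delta_vec_index) auto
    then show ?thesis
      by (simp only: of_bool_add_bit) (cases "k = r"; cases "k = Suc r"; simp)
  qed
  finally show ?case .
qed

section \<open>Action of the generators on index sets\<close>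

lemma flip_mat_delta_comb_index:
  assumes "n \<ge> 6" "s \<in> {1..n}" "r < n"
  shows "(flip_mat n s *\<^sub>v delta_comb n A) $ r =
    (\<Sum>i\<in>A. delta_vec n i $ r + of_bool ({Suc r, s} \<in> E_edges n) * delta_vec n i $ (s - 1))"
proof -
  have "s - 1 < n" using assms(2) by auto
  show ?thesis
    unfolding flip_mat_mult_index[OF assms(1) delta_comb_carrier assms(3,2)]
      delta_comb_index[OF assms(3)] delta_comb_index[OF \<open>s - 1 < n\<close>]
      sum.distrib sum_distrib_left by (rule refl)
qed

text \<open>For \<open>s < n\<close> only the basis vectors with indices \<open>s\<close> and
  \<open>Suc s\<close> have coordinate 1 at the vertex \<open>s\<close>; all others are fixed. These
  two differ by the sum of the neighbours of \<open>s\<close>, so the matrix swaps them.\<close>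

lemma flip_mat_delta_comb_transpose:
  assumes n: "n \<ge> 6" and s: "1 \<le> s" "s < n" and A: "A \<subseteq> {1..n}"
  shows "flip_mat n s *\<^sub>v delta_comb n A = delta_comb n (transpose s (Suc s) ` A)"
proof (rule eq_vecI)
  fix r assume "r < dim_vec (delta_comb n (transpose s (Suc s) ` A))"
  then have r: "r < n" by (simp add: delta_comb_def)
  have "(flip_mat n s *\<^sub>v delta_comb n A) $ r =
    (\<Sum>i\<in>A. delta_vec n i $ r + of_bool ({Suc r, s} \<in> E_edges n) * delta_vec n i $ (s - 1))"
    using n s r by (intro flip_mat_delta_comb_index) auto
  also have "\<dots> = (\<Sum>i\<in>A. delta_vec n (transpose s (Suc s) i) $ r)"
  proof (rule sum.cong)
    fix i assume "i \<in> A"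
    then have i: "1 \<le> i" "i \<le> n" using A by auto
    have shift: "delta_vec n (Suc s) $ r = delta_vec n s $ r + of_bool ({Suc r, s} \<in> E_edges n)"
    proof -
      have "delta_vec n s $ (s - 1) = 1" using n s by (simp add: delta_vec_index)
      then show ?thesis
        unfolding delta_vec_Suc[OF s(1)] using n s r
        by (subst flip_mat_mult_index) simp_all
    qed
    consider "i = s" | "i = Suc s" | "i \<noteq> s" "i \<noteq> Suc s" by blast
    then show "delta_vec n i $ r + of_bool ({Suc r, s} \<in> E_edges n) * delta_vec n i $ (s - 1) =
        delta_vec n (transpose s (Suc s) i) $ r"
    proof cases
      case 1
      have "delta_vec n i $ (s - 1) = 1" using n s 1 by (simp add: delta_vec_index)
      then show ?thesis using 1 shift by simp
    next
      case 2
      have "delta_vec n i $ (s - 1) = 1" using n s 2 by (simp add: delta_vec_index)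
      then show ?thesis using 2 shift by (cases "delta_vec n s $ r"; simp)
    next
      case 3
      have "delta_vec n i $ (s - 1) = 0" using n s i 3 by (simp add: delta_vec_index)
      then show ?thesis using 3 by simp
    qed
  qed auto
  also have "\<dots> = delta_comb n (transpose s (Suc s) ` A) $ r"
    unfolding delta_comb_index[OF r] by (subst sum.reindex) (auto intro!: inj_onI)
  finally show "(flip_mat n s *\<^sub>v delta_comb n A) $ r = delta_comb n (transpose s (Suc s) ` A) $ r" .
qed (simp add: delta_comb_def)

text \<open>The characteristic vector of \<open>s\<^sub>n\<^sub>-\<^sub>3\<close>, the only neighbour of \<open>s\<^sub>n\<close>, is the sum of the
  first \<open>n - 3\<close> elements of \<open>Delta n\<close>.\<close>

lemma flip_mat_delta_comb_last:
  assumes n: "n \<ge> 6" and A: "A \<subseteq> {1..n}"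
  shows "flip_mat n n *\<^sub>v delta_comb n A =
    delta_comb n (if odd (card (A \<inter> {n-2, n-1, n})) then sym_diff A {1..n-3} else A)"
    (is "_ = delta_comb n ?B")
proof (rule eq_vecI)
  fix r assume "r < dim_vec (delta_comb n ?B)"
  then have r: "r < n" by (simp add: delta_comb_def)
  have fin: "finite A" using A finite_subset by blast
  have "(flip_mat n n *\<^sub>v delta_comb n A) $ r = delta_comb n A $ r + 
      of_bool (Suc r = n - 3) * (\<Sum>i\<in>A. delta_vec n i $ (n - 1))"
  proof -
    have "{Suc r, n} \<in> E_edges n \<longleftrightarrow> Suc r = n - 3"
      using n r by (auto simp: E_edges_iff)
    moreover have "n \<in> {1..n}" using n by simp
    ultimately show ?thesis
      using n r by (simp only: flip_mat_delta_comb_index delta_comb_index sum.distrib sum_distrib_left)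
  qed
  \<comment> \<open>The vertex \<open>n\<close> occurs in exactly three basis vectors, so its
    coordinate in the sum is a parity.\<close>
  also have "(\<Sum>i\<in>A. delta_vec n i $ (n - 1)) = (\<Sum>i\<in>A. of_bool (i \<in> {n-2, n-1, n}))"
    by (rule sum.cong) (use A n in \<open>auto simp: delta_vec_index of_bool_def\<close>)
  also have "\<dots> = of_nat (card (A \<inter> {n-2, n-1, n}))"
    using fin by (subst sum_of_bool_eq) (auto simp: Int_def)
  also have "of_bool (Suc r = n - 3) = delta_comb n {1..n-3} $ r"
    by (rule delta_comb_initial_index[OF n order.refl r, symmetric])
  also have "delta_comb n A $ r + \<dots> * of_nat (card (A \<inter> {n-2, n-1, n})) = delta_comb n ?B $ r"
  proof -
    have "(of_nat c :: bit) = of_bool (odd c)" for c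
      by (induction c) auto
    then show ?thesis
      using r fin by (cases "odd (card (A \<inter> {n-2, n-1, n}))") (simp_all add: delta_comb_index sum_sym_diff_bit)
  qed
  finally show "(flip_mat n n *\<^sub>v delta_comb n A) $ r = delta_comb n ?B $ r" .
qed (simp add: delta_comb_def)

section \<open>The basis property and the weight\<close>

text \<open>The index sets are \<open>{1..k}\<close> for \<open>k \<le> n - 3\<close>, then
  \<open>{n-1, n}\<close> for the vertex \<open>n - 2\<close>, \<open>{1..n-1}\<close> for
  \<open>n - 1\<close> and \<open>{1..n}\<close> for \<open>n\<close>. The last two extend the
  telescoped sum over \<open>{1..n-3}\<close>.\<close>

lemma ex_sum_delta_vec_eq_char:
  assumes n: "n \<ge> 6" and k: "1 \<le> k" "k \<le> n"
  shows "\<exists>A \<subseteq> {1..n}. \<forall>r<n. (\<Sum>i\<in>A. delta_vec n i $ r) = of_bool (Suc r = k)"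
proof -
  have initial: "(\<Sum>i\<in>{1..n-3}. delta_vec n i $ r) = of_bool (Suc r = n - 3)" if "r < n" for r
    using delta_comb_initial_index[OF n order.refl that] that by (simp add: delta_comb_index)
  obtain m where m: "n = m + 6" using n by (metis le_add_diff_inverse2)
  have last: "delta_vec n (m + 4) $ r = of_bool (r = m + 2 \<or> r = m + 3 \<or> r = m + 5)"
      "delta_vec n (m + 5) $ r = of_bool (r = m + 3 \<or> r = m + 4 \<or> r = m + 5)"
      "delta_vec n (m + 6) $ r = of_bool (r = m + 4 \<or> r = m + 5)" if "r < n" for r
    by (subst delta_vec_index, use that n m in simp_all; rule arg_cong[of _ _ of_bool]; auto)+
  consider "k \<le> n - 3" | "k = m + 4" | "k = m + 5" | "k = m + 6" using k m by linarith
  then show ?thesis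
  proof cases
    case 1
    then show ?thesis
      using delta_comb_initial_index[OF n 1] k
      by (intro exI[of _ "{1..k}"]) (auto simp: delta_comb_index)
  next
    case 2
    have "(\<Sum>i\<in>{m+5, m+6}. delta_vec n i $ r) = of_bool (Suc r = k)" if "r < n" for r
      using last[OF that] 2
      by (cases "r = m + 3"; cases "r = m + 4"; cases "r = m + 5"; simp)
    then show ?thesis by (intro exI[of _ "{m+5, m+6}"]) (auto simp: m)
  next
    case 3
    have eq: "{1..m+5} = {1..n-3} \<union> {m+4, m+5}" using m by auto
    have "(\<Sum>i\<in>{1..m+5}. delta_vec n i $ r) = of_bool (Suc r = k)" if "r < n" for r
    proof -
      have "(\<Sum>i\<in>{1..m+5}. delta_vec n i $ r) =
          of_bool (Suc r = n - 3) + (delta_vec n (m + 4) $ r + delta_vec n (m + 5) $ r)"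
        unfolding eq initial[OF that, symmetric] by (subst sum.union_disjoint) (auto simp: m)
      also have "\<dots> = of_bool (Suc r = k)"
        using last[OF that] 3 m
        by (cases "r = m + 2"; cases "r = m + 3"; cases "r = m + 4"; cases "r = m + 5"; simp)
      finally show ?thesis .
    qed
    then show ?thesis by (intro exI[of _ "{1..m+5}"]) (auto simp: m)
  next
    case 4
    have eq: "{1..m+6} = {1..n-3} \<union> {m+4, m+5, m+6}" using m by auto
    have "(\<Sum>i\<in>{1..m+6}. delta_vec n i $ r) = of_bool (Suc r = k)" if "r < n" for r
    proof -
      have "(\<Sum>i\<in>{1..m+6}. delta_vec n i $ r) = of_bool (Suc r = n - 3) +
          (delta_vec n (m + 4) $ r + (delta_vec n (m + 5) $ r + delta_vec n (m + 6) $ r))"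
        unfolding eq initial[OF that, symmetric] by (subst sum.union_disjoint) (auto simp: m)
      also have "\<dots> = of_bool (Suc r = k)"
        using last[OF that] 4 m
        by (cases "r = m + 2"; cases "r = m + 3"; cases "r = m + 4"; cases "r = m + 5"; simp)
      finally show ?thesis .
    qed
    then show ?thesis by (intro exI[of _ "{1..m+6}"]) (auto simp: m)
  qed
qed

text \<open>Induction over the support of the vector: adding a characteristic vector is a symmetric
  difference of index sets.\<close>

lemma delta_comb_surj:
  assumes n: "n \<ge> 6"
  shows "delta_comb n ` Pow {1..n} = carrier_vec n"
proof (intro equalityI subsetI)
  fix v :: "bit vec" assume v: "v \<in> carrier_vec n"
  have "\<exists>A \<subseteq> {1..n}. \<forall>r<n. (\<Sum>i\<in>A. delta_vec n i $ r) = of_bool (Suc r \<in> B)"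
    if "B \<subseteq> {1..n}" for B
    using finite_subset[OF that finite_atLeastAtMost] that
  proof (induction B rule: finite_induct)
    case (insert k B)
    then obtain A where A: "A \<subseteq> {1..n}"
      "\<And>r. r < n \<Longrightarrow> (\<Sum>i\<in>A. delta_vec n i $ r) = of_bool (Suc r \<in> B)"
      by auto
    obtain C where C: "C \<subseteq> {1..n}"
      "\<And>r. r < n \<Longrightarrow> (\<Sum>i\<in>C. delta_vec n i $ r) = of_bool (Suc r = k)"
      using ex_sum_delta_vec_eq_char[OF n, of k] insert.prems by auto
    have fin: "finite A" "finite C" using A(1) C(1) finite_subset by blast+
    have "(\<Sum>i\<in>sym_diff A C. delta_vec n i $ r) = of_bool (Suc r \<in> insert k B)" if "r < n" for r
      unfolding sum_sym_diff_bit[OF fin] A(2)[OF that] C(2)[OF that]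
      using insert.hyps(2) by (auto simp: of_bool_def)
    moreover have "sym_diff A C \<subseteq> {1..n}" using A(1) C(1) by blast
    ultimately show ?case by blast
  qed (auto intro: exI[of _ "{}"])
  moreover have "{k \<in> {1..n}. v $ (k - 1) = 1} \<subseteq> {1..n}" by blast
  ultimately obtain A where A: "A \<subseteq> {1..n}"
    "\<forall>r<n. (\<Sum>i\<in>A. delta_vec n i $ r) = of_bool (Suc r \<in> {k \<in> {1..n}. v $ (k - 1) = 1})"
    by meson
  have "v = delta_comb n A"
    using v A(2) by (intro eq_vecI) (auto simp: delta_comb_def)
  then show "v \<in> delta_comb n ` Pow {1..n}" using A(1) by blast
qed auto

text \<open>Injectivity follows from surjectivity, since \<open>carrier_vec n\<close> is at least as large as
  \<open>Pow {1..n}\<close>.\<close>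

lemma inj_on_delta_comb:
  assumes n: "n \<ge> 6"
  shows "inj_on (delta_comb n) (Pow {1..n})"
proof -
  let ?g = "\<lambda>B. vec n (\<lambda>r. of_bool (Suc r \<in> B)) :: bit vec"
  have "inj_on ?g (Pow {1..n})"
  proof (rule inj_onI)
    fix B C assume BC: "B \<in> Pow {1..n}" "C \<in> Pow {1..n}" "?g B = ?g C"
    have "k \<in> B \<longleftrightarrow> k \<in> C" if "k \<in> {1..n}" for k
      using arg_cong[OF BC(3), of "\<lambda>v. v $ (k - 1)"] that by (auto split: if_splits)
    then show "B = C" using BC(1,2) by blast
  qed
  moreover have "?g ` Pow {1..n} \<subseteq> delta_comb n ` Pow {1..n}"
    unfolding delta_comb_surj[OF n] by auto
  ultimately have "card (Pow {1..n}) \<le> card (delta_comb n ` Pow {1..n})"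
    by (intro card_inj_on_le[of ?g]) auto
  then show ?thesis
    by (intro eq_card_imp_inj_on antisym card_image_le) auto
qed

text \<open>Over two elements, any coefficient function gives the subset sum of its support.
  Injectivity of \<open>delta_comb n\<close> therefore determines the support of the chosen
  \<open>Delta_coeff\<close>.\<close>

lemma wt_delta_comb:
  assumes n: "n \<ge> 6" and A: "A \<subseteq> {1..n}"
  shows "wt n (delta_comb n A) = card A"
proof -
  interpret vec_space "TYPE(bit)" n .
  have inj: "inj_on (delta_vec n) {1..n}"
  proof (rule inj_onI)
    fix i j assume "i \<in> {1..n}" "j \<in> {1..n}" "delta_vec n i = delta_vec n j"
    then show "i = j"
      using inj_onD[OF inj_on_delta_comb[OF n], of "{i}" "{j}"] by simp
  qed
  have comb: "lincomb c (Delta n) = delta_comb n {i \<in> {1..n}. c (delta_vec n i) \<noteq> 0}" for c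
  proof (rule eq_vecI)
    have sub: "Delta n \<subseteq> carrier_vec n" by (auto simp: Delta_def)
    have "lincomb c (Delta n) \<in> carrier_vec n" using sub by (rule lincomb_closed)
    then show "dim_vec (lincomb c (Delta n)) = dim_vec (delta_comb n {i \<in> {1..n}. c (delta_vec n i) \<noteq> 0})"
      by (simp add: delta_comb_def)
    fix r assume "r < dim_vec (delta_comb n {i \<in> {1..n}. c (delta_vec n i) \<noteq> 0})"
    then have r: "r < n" by (simp add: delta_comb_def)
    have "lincomb c (Delta n) $ r = (\<Sum>i\<in>{1..n}. c (delta_vec n i) * delta_vec n i $ r)"
      unfolding lincomb_index[OF r sub] unfolding Delta_def sum.reindex[OF inj] by (simp only: o_def)
    also have "\<dots> = (\<Sum>i\<in>{i \<in> {1..n}. c (delta_vec n i) \<noteq> 0}. delta_vec n i $ r)"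
      by (rule sum.mono_neutral_cong_right) auto
    finally show "lincomb c (Delta n) $ r = delta_comb n {i \<in> {1..n}. c (delta_vec n i) \<noteq> 0} $ r"
      using r by (simp add: delta_comb_index)
  qed
  \<comment> \<open>The indicator of the chosen basis vectors shows that an expression exists, as
    \<open>someI\<close> requires.\<close>
  define c where "c d = (of_bool (d \<in> delta_vec n ` A) :: bit)" for d
  have "{i \<in> {1..n}. c (delta_vec n i) \<noteq> 0} = A"
    using A inj_on_image_mem_iff[OF inj _ A] by (auto simp: c_def)
  then have "lincomb c (Delta n) = delta_comb n A" unfolding comb by simp
  then have "lincomb (Delta_coeff n (delta_comb n A)) (Delta n) = delta_comb n A"
    unfolding Delta_coeff_def by (rule someI[of "\<lambda>c. lincomb c (Delta n) = delta_comb n A"])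
  then have "{i \<in> {1..n}. Delta_coeff n (delta_comb n A) (delta_vec n i) \<noteq> 0} = A"
    unfolding comb using A by (intro inj_onD[OF inj_on_delta_comb[OF n]]) auto
  then have "{d \<in> Delta n. Delta_coeff n (delta_comb n A) d \<noteq> 0} = delta_vec n ` A"
    unfolding Delta_def by blast
  then show ?thesis
    using card_image[OF inj_on_subset[OF inj A]] by (simp add: wt_def)
qed

section \<open>Orbits as reachability by generators\<close>

definition flip_step :: "nat \<Rightarrow> bit vec \<Rightarrow> bit vec \<Rightarrow> bool" where
  "flip_step n x y \<longleftrightarrow> x \<in> carrier_vec n \<and> (\<exists>s \<in> {1..n}. y = flip_mat n s *\<^sub>v x)"

lemma flip_mat_mult_twice:
  assumes "n \<ge> 6" "x \<in> carrier_vec n"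
  shows "flip_mat n s *\<^sub>v (flip_mat n s *\<^sub>v x) = x"
  using assms assoc_mult_mat_vec[OF flip_mat_carrier flip_mat_carrier assms(2), of s s]
  by (simp add: flip_mat_involution)

lemma symp_flip_step: "n \<ge> 6 \<Longrightarrow> symp (flip_step n)"
  by (intro sympI) (auto simp: flip_step_def mult_mat_vec_carrier[OF flip_mat_carrier]
    flip_mat_mult_twice intro!: bexI)

lemma flip_steps_sym: "n \<ge> 6 \<Longrightarrow> (flip_step n)\<^sup>*\<^sup>* x y \<Longrightarrow> (flip_step n)\<^sup>*\<^sup>* y x"
  using symp_rtranclp[OF symp_flip_step] by (blast dest: sympD)

lemma group_GL2: "group (GL2 n)"
proof -
  interpret R: ring "ring_mat TYPE(bit) n ()" by (rule ring_mat)
  show ?thesis unfolding GL2_def by (rule R.units_group)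
qed

text \<open>Each generator is its own inverse, so every group element is a product of generators and
  its action is a chain of steps.\<close>

lemma orbit_flipping_group:
  assumes n: "n \<ge> 6" and x: "x \<in> carrier_vec n"
  shows "Group_Action.orbit (flipping_group n) (\<lambda>A v. A *\<^sub>v v) x = {y. (flip_step n)\<^sup>*\<^sup>* x y}"
proof -
  interpret G: group "GL2 n" by (rule group_GL2)
  have ops: "g \<otimes>\<^bsub>GL2 n\<^esub> h = g * h" "\<one>\<^bsub>GL2 n\<^esub> = 1\<^sub>m n" for g h
    by (simp_all add: GL2_def units_of_def ring_mat_simps)
  have inverse: "inv\<^bsub>GL2 n\<^esub> (flip_mat n s) = flip_mat n s" for s
    using n by (intro G.inv_equality) (auto simp: ops flip_mat_involution flip_mat_in_GL2)
  let ?H = "generate (GL2 n) (flip_mat n ` {1..n})"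
  have carrier: "carrier (flipping_group n) = ?H"
    using flip_mat_in_GL2[OF n] unfolding flipping_group_def E_vertices_def
    by (simp add: carrier_subgroup_generated Int_absorb1 image_subset_iff)
  \<comment> \<open>The claim ranges over all vectors because in a product \<open>g * h\<close> the
    factor \<open>g\<close> acts on \<open>h *\<^sub>v x\<close>.\<close>
  have "g \<in> carrier_mat n n \<and> (\<forall>x \<in> carrier_vec n. (flip_step n)\<^sup>*\<^sup>* x (g *\<^sub>v x))" if "g \<in> ?H" for g
    using that
  proof (induction g rule: generate.induct)
    case (eng g h)
    have "(flip_step n)\<^sup>*\<^sup>* x (g * h *\<^sub>v x)" if x: "x \<in> carrier_vec n" for x
    proof -
      have "h *\<^sub>v x \<in> carrier_vec n" using eng x by (auto intro: mult_mat_vec_carrier)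
      then have "(flip_step n)\<^sup>*\<^sup>* x (g *\<^sub>v (h *\<^sub>v x))"
        using eng x by (meson rtranclp_trans)
      then show ?thesis using eng x by (simp add: assoc_mult_mat_vec[of g n n h n x])
    qed
    then show ?case using eng by (auto simp: ops)
  qed (auto simp: ops inverse flip_step_def intro!: r_into_rtranclp)
  moreover have "\<exists>g \<in> ?H. g \<in> carrier_mat n n \<and> y = g *\<^sub>v x" if "(flip_step n)\<^sup>*\<^sup>* x y" for y
    using that
  proof (induction rule: rtranclp_induct)
    case base
    show ?case using x generate.one[of "GL2 n"] by (intro bexI[of _ "1\<^sub>m n"]) (auto simp: ops)
  next
    case (step y z)
    then obtain g s where g: "g \<in> ?H" "g \<in> carrier_mat n n" "y = g *\<^sub>v x"
      and s: "s \<in> {1..n}" "z = flip_mat n s *\<^sub>v y"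
      by (auto simp: flip_step_def)
    have "flip_mat n s \<otimes>\<^bsub>GL2 n\<^esub> g \<in> ?H"
      using generate.eng[OF generate.incl g(1)] s(1) by blast
    then show ?case
      using g s x
      by (intro bexI[of _ "flip_mat n s * g"])
        (auto simp: ops assoc_mult_mat_vec[OF flip_mat_carrier g(2) x] intro: mult_carrier_mat[OF flip_mat_carrier])
  qed
  ultimately show ?thesis
    using x unfolding Group_Action.orbit_def carrier by blast
qed

section \<open>Connecting the weights\<close>

text \<open>This is sorting by adjacent transpositions. Moving an element down into a gap lowers the
  sum of \<open>A\<close>, and a set without such a gap is an initial segment.\<close>

lemma flip_steps_initial:
  assumes n: "n \<ge> 6"
  shows "A \<subseteq> {1..n} \<Longrightarrow> (flip_step n)\<^sup>*\<^sup>* (delta_comb n A) (delta_comb n {1..card A})"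
proof (induction "\<Sum>A" arbitrary: A rule: less_induct)
  case less
  have fin: "finite A" using less.prems finite_subset by blast
  show ?case
  proof (cases "\<exists>i\<ge>1. i \<notin> A \<and> Suc i \<in> A")
    case True
    then obtain i where i: "1 \<le> i" "i \<notin> A" "Suc i \<in> A" by blast
    then have i_less: "i < n" using less.prems by auto
    let ?B = "transpose i (Suc i) ` A"
    have B: "?B = insert i (A - {Suc i})"
      using i by (auto simp: transpose_def image_iff split: if_splits)
    have "\<Sum>?B = i + \<Sum>(A - {Suc i})" unfolding B using fin i by simp
    moreover have "\<Sum>A = Suc i + \<Sum>(A - {Suc i})" using fin i by (intro sum.remove)
    ultimately have "\<Sum>?B < \<Sum>A" by simp
    moreover have "?B \<subseteq> {1..n}" unfolding B using i i_less less.prems by auto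
    moreover have "card ?B = card A" by (intro card_image) (auto intro!: inj_onI)
    ultimately have "(flip_step n)\<^sup>*\<^sup>* (delta_comb n ?B) (delta_comb n {1..card A})"
      using less.hyps by metis
    moreover have "flip_step n (delta_comb n A) (delta_comb n ?B)"
      unfolding flip_step_def using flip_mat_delta_comb_transpose[OF n i(1) i_less less.prems] i i_less
      by (intro conjI bexI[of _ i]) auto
    ultimately show ?thesis by (rule converse_rtranclp_into_rtranclp[rotated])
  next
    case False
    have "A = {1..card A}"
    proof (cases "A = {}")
      case nonempty: False
      \<comment> \<open>Without gaps, membership descends from \<open>Max A\<close> to 1.\<close>
      have "k \<in> A" if "k \<le> Max A" "1 \<le> k" for k
        using that False
        by (induction rule: inc_induct) (use fin nonempty in auto)
      moreover have "1 \<le> k \<and> k \<le> Max A" if "k \<in> A" for k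
        using that less.prems fin by auto
      ultimately have A: "A = {1..Max A}" unfolding set_eq_iff atLeastAtMost_iff by blast
      then have "card A = card {1..Max A}" by (rule arg_cong)
      then show ?thesis using A by simp
    qed simp
    then show ?thesis by simp
  qed
qed

lemma flip_steps_same_card:
  assumes "n \<ge> 6" "A \<subseteq> {1..n}" "B \<subseteq> {1..n}" "card A = card B"
  shows "(flip_step n)\<^sup>*\<^sup>* (delta_comb n A) (delta_comb n B)"
  using flip_steps_initial[of n A] flip_steps_initial[of n B] flip_steps_sym[of n] assms
  by (metis rtranclp_trans)

lemma flip_step_last:
  assumes n: "n \<ge> 6" and A: "A \<subseteq> {1..n}" and odd: "odd (card (A \<inter> {n-2, n-1, n}))"
  shows "flip_step n (delta_comb n A) (delta_comb n (sym_diff A {1..n-3}))"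
  unfolding flip_step_def using flip_mat_delta_comb_last[OF n A] odd n
  by (intro conjI bexI[of _ n]) auto

text \<open>A representative of weight \<open>w\<close> is chosen with only \<open>n\<close> among
  the last three indices, so that the last generator complements the remaining \<open>w - 1\<close>
  indices.\<close>

lemma flip_steps_weight_reflect1:
  assumes n: "n \<ge> 6" and w: "1 \<le> w" "w \<le> n - 2"
  shows "(flip_step n)\<^sup>*\<^sup>* (delta_comb n {1..w}) (delta_comb n {1..n-1-w})"
proof -
  let ?A = "insert n {1..w-1}" and ?B = "insert n {w..n-3}"
  have inter: "?A \<inter> {n-2, n-1, n} = {n}" and diff: "sym_diff ?A {1..n-3} = ?B"
    using n w by auto
  have sub: "?A \<subseteq> {1..n}" "?B \<subseteq> {1..n}" using n w by auto
  have "flip_step n (delta_comb n ?A) (delta_comb n ?B)"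
    using flip_step_last[OF n sub(1)] unfolding inter diff by simp
  moreover have "(flip_step n)\<^sup>*\<^sup>* (delta_comb n {1..w}) (delta_comb n ?A)"
    using n w sub by (intro flip_steps_same_card) auto
  moreover have "card ?B = n - 1 - w" using n w by (subst card_insert_disjoint) auto
  then have "(flip_step n)\<^sup>*\<^sup>* (delta_comb n ?B) (delta_comb n {1..n-1-w})"
    using sub by (intro flip_steps_same_card[OF n]) auto
  ultimately show ?thesis by (meson rtranclp.rtrancl_into_rtrancl rtranclp_trans)
qed

text \<open>Here the representative contains all three of the last indices, and the other
  \<open>w - 3\<close> are complemented.\<close>

lemma flip_steps_weight_reflect2:
  assumes n: "n \<ge> 6" and w: "3 \<le> w" "w \<le> n"
  shows "(flip_step n)\<^sup>*\<^sup>* (delta_comb n {1..w}) (delta_comb n {1..n+3-w})"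
proof -
  let ?T = "{n-2, n-1, n}"
  let ?A = "{1..w-3} \<union> ?T" and ?B = "{w-2..n-3} \<union> ?T"
  have T: "card ?T = 3" using n by (auto simp: card_insert_if)
  have le: "n + 3 - w \<le> n" using w by simp
  have "?A \<inter> ?T = ?T" by auto
  moreover have "sym_diff ?A {1..n-3} = ?B" using n w by auto
  moreover have sub: "?A \<subseteq> {1..n}" "?B \<subseteq> {1..n}" using n w by auto
  ultimately have "flip_step n (delta_comb n ?A) (delta_comb n ?B)"
    using flip_step_last[OF n sub(1)] T by simp
  moreover have "card ?A = w" using n w T by (subst card_Un_disjoint) auto
  then have "(flip_step n)\<^sup>*\<^sup>* (delta_comb n {1..w}) (delta_comb n ?A)"
    using n w sub by (intro flip_steps_same_card) auto
  moreover have "card ?B = n + 3 - w" using n w T by (subst card_Un_disjoint) auto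
  then have "(flip_step n)\<^sup>*\<^sup>* (delta_comb n ?B) (delta_comb n {1..n+3-w})"
    using le sub by (intro flip_steps_same_card[OF n]) simp_all
  ultimately show ?thesis by (meson rtranclp.rtrancl_into_rtrancl rtranclp_trans)
qed

lemma flip_steps_weight_cong:
  assumes n: "n \<ge> 6" and w: "1 \<le> v" "v \<le> n" "1 \<le> w" "w \<le> n" and cong: "[v = w] (mod 4)"
  shows "(flip_step n)\<^sup>*\<^sup>* (delta_comb n {1..v}) (delta_comb n {1..w})"
proof -
  have add: "(flip_step n)\<^sup>*\<^sup>* (delta_comb n {1..v}) (delta_comb n {1..v + 4 * k})"
    if "1 \<le> v" "v + 4 * k \<le> n" for v k
    using that
  proof (induction k)
    case (Suc k)
    let ?u = "v + 4 * k"
    \<comment> \<open>The slack \<open>d\<close> gives \<open>n - 1 - ?u = d + 3\<close>, which is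
      large enough for the second reflection.\<close>
    obtain d where d: "n = v + 4 * Suc k + d" using Suc.prems(2) le_Suc_ex by blast
    have "(flip_step n)\<^sup>*\<^sup>* (delta_comb n {1..v}) (delta_comb n {1..?u})"
      using Suc.prems by (intro Suc.IH) auto
    also have "(flip_step n)\<^sup>*\<^sup>* (delta_comb n {1..?u}) (delta_comb n {1..n-1-?u})"
      using n Suc.prems by (intro flip_steps_weight_reflect1) auto
    also have "(flip_step n)\<^sup>*\<^sup>* (delta_comb n {1..n-1-?u}) (delta_comb n {1..n+3-(n-1-?u)})"
      using Suc.prems(1) d by (intro flip_steps_weight_reflect2 n) auto
    also have "n + 3 - (n - 1 - ?u) = v + 4 * Suc k" unfolding d by simp
    finally show ?case .
  qed simp
  show ?thesis
  proof (cases "v \<le> w")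
    case True
    then obtain k where "w = k * 4 + v" using cong cong_le_nat[of v w 4] cong_sym by blast
    then show ?thesis using add[of v k] w by (simp add: algebra_simps)
  next
    case False
    then obtain k where "v = k * 4 + w" using cong cong_le_nat[of w v 4] by auto
    then show ?thesis using add[of w k] w flip_steps_sym[OF n] by (simp add: algebra_simps)
  qed
qed

section \<open>Weight classes are orbits\<close>

text \<open>The residue \<open>r\<close> and its reflection \<open>n - 1 - r\<close> are merged. The
  additive form of the second congruence makes sense for every \<open>r\<close>, without
  truncation.\<close>

definition weight_class :: "nat \<Rightarrow> nat \<Rightarrow> bit vec set" where
  "weight_class n r =
    {a \<in> carrier_vec n. a \<noteq> 0\<^sub>v n \<and> ([wt n a = r] (mod 4) \<or> [wt n a + r = n - 1] (mod 4))}"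

lemma delta_comb_eq_0_iff:
  assumes "n \<ge> 6" "A \<subseteq> {1..n}"
  shows "delta_comb n A = 0\<^sub>v n \<longleftrightarrow> A = {}"
  using inj_on_eq_iff[OF inj_on_delta_comb[OF assms(1)], of A "{}"] assms(2) by simp

lemma delta_comb_in_weight_class_iff:
  assumes "n \<ge> 6" "A \<subseteq> {1..n}"
  shows "delta_comb n A \<in> weight_class n r \<longleftrightarrow>
    A \<noteq> {} \<and> ([card A = r] (mod 4) \<or> [card A + r = n - 1] (mod 4))"
  using assms by (simp add: weight_class_def delta_comb_eq_0_iff wt_delta_comb)

text \<open>Reflection exchanges the two congruences; this yields the coincidences among the
  orbits.\<close>

lemma weight_class_reflect:
  assumes "[r + s = n - 1] (mod 4)"
  shows "weight_class n r = weight_class n s"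
proof -
  have "[w = r] (mod 4) \<longleftrightarrow> [w + s = n - 1] (mod 4)" for w
    using assms cong_add_rcancel_nat[of w s r 4] by (metis cong_trans cong_sym)
  moreover have "[w + r = n - 1] (mod 4) \<longleftrightarrow> [w = s] (mod 4)" for w
    using assms cong_add_rcancel_nat[of w r s 4] by (metis cong_trans cong_sym add.commute)
  ultimately show ?thesis unfolding weight_class_def by blast
qed

text \<open>Transpositions keep the cardinality. When the last generator acts nontrivially, the old
  and new cardinalities add up to \<open>n - 3 + 2 * j\<close> with \<open>j\<close> odd, hence to
  \<open>n - 1\<close> modulo 4, and the two congruences are exchanged.\<close>

lemma flip_step_weight_class:
  assumes n: "n \<ge> 6" and x: "x \<in> weight_class n r" and step: "flip_step n x y"
  shows "y \<in> weight_class n r"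
proof -
  obtain A where A: "A \<subseteq> {1..n}" "x = delta_comb n A"
    using x delta_comb_surj[OF n] unfolding weight_class_def by blast
  have fin: "finite A" using A finite_subset by blast
  note in_class = delta_comb_in_weight_class_iff[OF n]
  have xA: "A \<noteq> {}" "[card A = r] (mod 4) \<or> [card A + r = n - 1] (mod 4)"
    using x in_class[OF A(1)] unfolding A(2) by auto
  obtain s where s: "s \<in> {1..n}" "y = flip_mat n s *\<^sub>v x" using step by (auto simp: flip_step_def)
  show ?thesis
  proof (cases "s = n")
    case False
    let ?B = "transpose s (Suc s) ` A"
    have "y = delta_comb n ?B"
      using s False A n flip_mat_delta_comb_transpose[of n s A] by auto
    moreover have "?B \<subseteq> {1..n}"
      using A(1) s False by (auto simp: transpose_def)
    moreover have "card ?B = card A" by (intro card_image) (auto intro!: inj_onI)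
    ultimately show ?thesis using in_class xA by simp
  next
    case True
    let ?T = "{n-2, n-1, n}" and ?I = "{1..n-3}"
    show ?thesis
    proof (cases "odd (card (A \<inter> ?T))")
      case odd: True
      let ?B = "sym_diff A ?I"
      have y: "y = delta_comb n ?B"
        using s True A n odd flip_mat_delta_comb_last[OF n A(1)] by simp
      have B: "?B \<subseteq> {1..n}" using A(1) by auto
      define i j where "i = card (A \<inter> ?I)" and "j = card (A \<inter> ?T)"
      have "{1..n} \<subseteq> ?I \<union> ?T" by auto
      then have "A = (A \<inter> ?I) \<union> (A \<inter> ?T)" using A(1) by blast
      then have "card A = card ((A \<inter> ?I) \<union> (A \<inter> ?T))" by simp
      also have "\<dots> = i + j"
        unfolding i_def j_def using fin n by (intro card_Un_disjoint) auto
      finally have card_A: "card A = i + j" .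
      have "?B = (?I - (A \<inter> ?I)) \<union> (A \<inter> ?T)" using A(1) n by auto
      then have "card ?B = card ((?I - (A \<inter> ?I)) \<union> (A \<inter> ?T))" by simp
      also have "\<dots> = card (?I - (A \<inter> ?I)) + j"
        unfolding j_def using fin n by (intro card_Un_disjoint) auto
      also have "card (?I - (A \<inter> ?I)) = n - 3 - i"
        unfolding i_def using fin by (subst card_Diff_subset) auto
      finally have card_B: "card ?B = n - 3 - i + j" .
      have "j \<le> card ?T" unfolding j_def by (intro card_mono) auto
      also have "\<dots> \<le> 3" by (simp add: card_insert_if)
      finally have j: "j = 1 \<or> j = 3" using odd unfolding j_def[symmetric] by presburger
      have "i \<le> card ?I" unfolding i_def by (intro card_mono) auto
      then have "card A + card ?B = n - 3 + 2 * j" unfolding card_A card_B by simp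
      also have "[n - 3 + 2 * j = n - 1] (mod 4)"
        using j n by (auto simp: cong_def mod_add_eq le_mod_geq)
      finally have sum: "[card A + card ?B = n - 1] (mod 4)" .
      \<comment> \<open>The zero vector could only come from \<open>A = ?I\<close>, which contains
        none of the last three indices.\<close>
      have "?B \<noteq> {}"
      proof
        assume "?B = {}"
        then have "A = ?I" by auto
        then have "A \<inter> ?T = {}" using n by auto
        then show False using odd by simp
      qed
      moreover have "[card ?B = r] (mod 4) \<or> [card ?B + r = n - 1] (mod 4)"
        using xA(2)
      proof
        assume "[card A = r] (mod 4)"
        then have "[card A + card ?B = r + card ?B] (mod 4)" by (intro cong_add cong_refl)
        then show ?thesis using sum by (metis cong_trans cong_sym add.commute)
      next
        assume "[card A + r = n - 1] (mod 4)"
        then have "[card A + card ?B = card A + r] (mod 4)" using sum cong_trans cong_sym by blast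
        then show ?thesis by (simp add: cong_add_lcancel_nat)
      qed
      ultimately show ?thesis unfolding y in_class[OF B] by blast
    next
      case False
      then have "y = x" using s True A n flip_mat_delta_comb_last[OF n A(1)] by simp
      then show ?thesis using x by simp
    qed
  qed
qed

text \<open>Both vectors are moved to initial segments with size congruent to \<open>r\<close>;
  those are connected by \<open>flip_steps_weight_cong\<close>.\<close>

lemma flip_steps_weight_class:
  assumes n: "n \<ge> 6" and x: "x \<in> weight_class n r" and y: "y \<in> weight_class n r"
  shows "(flip_step n)\<^sup>*\<^sup>* x y"
proof -
  have to_r: "\<exists>w. 1 \<le> w \<and> w \<le> n \<and> [w = r] (mod 4) \<and> (flip_step n)\<^sup>*\<^sup>* z (delta_comb n {1..w})"
    if z: "z \<in> weight_class n r" for z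
  proof -
    obtain A where A: "A \<subseteq> {1..n}" "z = delta_comb n A"
      using z delta_comb_surj[OF n] unfolding weight_class_def by blast
    have fin: "finite A" using A finite_subset by blast
    have zA: "A \<noteq> {}" "[card A = r] (mod 4) \<or> [card A + r = n - 1] (mod 4)"
      using z delta_comb_in_weight_class_iff[OF n A(1)] unfolding A(2) by auto
    have card: "1 \<le> card A" "card A \<le> n"
      using zA(1) fin card_mono[OF _ A(1)] by (auto simp: Suc_le_eq card_gt_0_iff)
    have steps: "(flip_step n)\<^sup>*\<^sup>* z (delta_comb n {1..card A})"
      unfolding A(2) by (rule flip_steps_initial[OF n A(1)])
    show ?thesis
    proof (cases "[card A = r] (mod 4)")
      case True
      then show ?thesis using card steps by blast
    next
      case False
      \<comment> \<open>The shift selects the representative in 1 to 4 instead of 0 to 3. It is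
        positive and at most \<open>n - 2\<close>, so it can be reflected, and
        \<open>n - 1 - w\<close> is positive too.\<close>
      define w where "w = (card A - 1) mod 4 + 1"
      have w: "1 \<le> w" "w \<le> 4" by (auto simp: w_def)
      have cong_w: "[card A = w] (mod 4)"
      proof -
        have "[card A - 1 + 1 = w] (mod 4)" unfolding w_def by (intro cong_add) (auto simp: cong_def)
        then show ?thesis using card by simp
      qed
      have "[w + r = n - 1] (mod 4)"
        using zA(2) False cong_w by (metis cong_add_rcancel_nat cong_sym cong_trans)
      then have "[n - 1 - w + w = r + w] (mod 4)"
        using n w by (simp add: add.commute cong_sym)
      then have "[n - 1 - w = r] (mod 4)" by (simp add: cong_add_rcancel_nat)
      moreover have "(flip_step n)\<^sup>*\<^sup>* (delta_comb n {1..card A}) (delta_comb n {1..w})"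
        using n w card cong_w by (intro flip_steps_weight_cong) auto
      moreover have "(flip_step n)\<^sup>*\<^sup>* (delta_comb n {1..w}) (delta_comb n {1..n-1-w})"
        using n w by (intro flip_steps_weight_reflect1) auto
      ultimately show ?thesis
        using steps n w by (intro exI[of _ "n - 1 - w"]) (auto intro: rtranclp_trans)
    qed
  qed
  obtain v where v: "1 \<le> v" "v \<le> n" "[v = r] (mod 4)" "(flip_step n)\<^sup>*\<^sup>* x (delta_comb n {1..v})"
    using to_r[OF x] by blast
  obtain w where w: "1 \<le> w" "w \<le> n" "[w = r] (mod 4)" "(flip_step n)\<^sup>*\<^sup>* y (delta_comb n {1..w})"
    using to_r[OF y] by blast
  have "(flip_step n)\<^sup>*\<^sup>* (delta_comb n {1..v}) (delta_comb n {1..w})"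
    using n v w by (intro flip_steps_weight_cong) (auto intro: cong_trans cong_sym)
  then show ?thesis using v(4) flip_steps_sym[OF n w(4)] by (meson rtranclp_trans)
qed

lemma orbit_weight_class:
  assumes n: "n \<ge> 6" and x: "x \<in> weight_class n r"
  shows "Group_Action.orbit (flipping_group n) (\<lambda>A v. A *\<^sub>v v) x = weight_class n r"
proof -
  have "y \<in> weight_class n r" if "(flip_step n)\<^sup>*\<^sup>* x y" for y
    using that
  proof induction
    case base
    show ?case by (rule x)
  next
    case (step y z)
    then show ?case using flip_step_weight_class[OF n] by blast
  qed
  moreover have "x \<in> carrier_vec n" using x by (simp add: weight_class_def)
  ultimately show ?thesis
    using flip_steps_weight_class[OF n x] orbit_flipping_group[OF n] by blast
qed

lemma orbit_zero:
  assumes n: "n \<ge> 6"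
  shows "Group_Action.orbit (flipping_group n) (\<lambda>A v. A *\<^sub>v v) (0\<^sub>v n) = {0\<^sub>v n}"
proof -
  have zero: "flip_mat n s *\<^sub>v 0\<^sub>v n = 0\<^sub>v n" for s
    by (intro eq_vecI) (auto simp: scalar_prod_def)
  have "y = 0\<^sub>v n" if "(flip_step n)\<^sup>*\<^sup>* (0\<^sub>v n) y" for y
    using that by induction (auto simp: flip_step_def zero)
  then show ?thesis by (subst orbit_flipping_group[OF n]) auto
qed

lemma weight_class_nonempty:
  assumes "n \<ge> 6"
  shows "weight_class n r \<noteq> {}"
proof -
  \<comment> \<open>Adding 3 replaces subtracting 1 modulo 4; the result is the representative of
    \<open>r\<close> in 1 to 4, a possible nonzero weight.\<close>
  define w where "w = (r + 3) mod 4 + 1"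
  have "[r + 3 + 1 = w] (mod 4)" unfolding w_def by (intro cong_add) (auto simp: cong_def)
  then have "[w = r] (mod 4)" by (auto simp: cong_def)
  moreover have "1 \<le> w" "w \<le> 4" by (auto simp: w_def)
  ultimately have "delta_comb n {1..w} \<in> weight_class n r"
    using assms by (subst delta_comb_in_weight_class_iff) auto
  then show ?thesis by blast
qed

section \<open>The list of orbits\<close>

text \<open>A nonzero vector lies in the class of its own weight modulo 4, so four residues suffice.
  Conversely each class is nonempty, hence the orbit of any of its members.\<close>

lemma orbits_eq_weight_classes:
  assumes n: "n \<ge> 6"
  shows "flipping_orbits n =
    {{0\<^sub>v n}, weight_class n 1, weight_class n 2, weight_class n 3, weight_class n 0}" (is "_ = ?R")
proof (intro equalityI subsetI)
  fix X assume "X \<in> flipping_orbits n"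
  then obtain x where x: "x \<in> carrier_vec n"
    and X: "X = Group_Action.orbit (flipping_group n) (\<lambda>A v. A *\<^sub>v v) x"
    unfolding flipping_orbits_def Group_Action.orbits_def by auto
  show "X \<in> ?R"
  proof (cases "x = 0\<^sub>v n")
    case True
    then show ?thesis using X orbit_zero[OF n] by simp
  next
    case False
    then have "x \<in> weight_class n (wt n x mod 4)"
      using x by (auto simp: weight_class_def cong_def)
    then have "X = weight_class n (wt n x mod 4)" unfolding X by (rule orbit_weight_class[OF n])
    moreover have "wt n x mod 4 < 4" by simp
    then have "wt n x mod 4 \<in> {0, 1, 2, 3}" by auto
    ultimately show ?thesis by auto
  qed
next
  fix X assume X: "X \<in> ?R"
  have zero: "{0\<^sub>v n} \<in> flipping_orbits n"
    using orbit_zero[OF n] zero_carrier_vec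
    unfolding flipping_orbits_def Group_Action.orbits_def by blast
  have "weight_class n r \<in> flipping_orbits n" for r
  proof -
    obtain x where x: "x \<in> weight_class n r" using weight_class_nonempty[OF n] by blast
    then have "x \<in> carrier_vec n" by (simp add: weight_class_def)
    then show ?thesis
      using orbit_weight_class[OF n x]
      unfolding flipping_orbits_def Group_Action.orbits_def by blast
  qed
  then show "X \<in> flipping_orbits n" using X zero by blast
qed

text \<open>Modulo 4, the second residues \<open>n - 2\<close>, \<open>n - 3\<close>,
  \<open>n\<close> and \<open>n - 1\<close> are the reflections of 1, 2, 3 and 0. For 3 this uses
  that \<open>n + 3\<close> is congruent to \<open>n - 1\<close>.\<close>

lemma O_eq_weight_class:
  assumes n: "n \<ge> 6"
  shows "O_1 n = weight_class n 1" "O_2 n = weight_class n 2"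
    "O_3 n = weight_class n 3" "O_4 n = weight_class n 0"
proof -
  have cancel: "[w + c = n - 1] (mod 4) \<longleftrightarrow> [w = d] (mod 4)" if "[n - 1 = d + c] (mod 4)" for w c d
    using that cong_add_rcancel_nat[of w c d 4] by (meson cong_trans cong_sym)
  have "n - 1 = n - 2 + 1" "n - 1 = n - 3 + 2" "n + 3 = n - 1 + 4" using n by auto
  then have "[n - 1 = n - 2 + 1] (mod 4)" "[n - 1 = n - 3 + 2] (mod 4)" "[n - 1 = n + 3] (mod 4)"
    by (simp_all only: cong_def mod_add_self2)
  note cancel[OF this(1)] cancel[OF this(2)] cancel[OF this(3)]
  then show "O_1 n = weight_class n 1" "O_2 n = weight_class n 2"
    "O_3 n = weight_class n 3" "O_4 n = weight_class n 0"
    unfolding O_1_def O_2_def O_3_def O_4_def weight_class_def by simp_all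
qed

theorem proposition7p3:
  fixes n :: nat
  assumes "n \<ge> 6"
  shows "flipping_orbits n = {O_0 n, O_1 n, O_2 n, O_3 n, O_4 n} \<and>
    ([n = 1] (mod 4) \<longrightarrow> O_1 n = O_3 n) \<and>
    ([n = 2] (mod 4) \<longrightarrow> O_1 n = O_4 n \<and> O_2 n = O_3 n) \<and>
    ([n = 3] (mod 4) \<longrightarrow> O_2 n = O_4 n) \<and>
    ([n = 0] (mod 4) \<longrightarrow> O_1 n = O_2 n \<and> O_3 n = O_4 n)"
proof -
  \<comment> \<open>Adding 1 on both sides states the reflection condition without the subtraction
    \<open>n - 1\<close>.\<close>
  have reflect: "weight_class n r = weight_class n s" if "[n = r + s + 1] (mod 4)" for r s
  proof (rule weight_class_reflect)
    have "[n - 1 + 1 = r + s + 1] (mod 4)" using that assms by simp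
    then show "[r + s = n - 1] (mod 4)" by (simp only: cong_add_rcancel_nat cong_sym_eq)
  qed
  \<comment> \<open>Each case pairs residues that are reflections of each other; the residue 0
    stands for \<open>O_4\<close>.\<close>
  have "[n = 1] (mod 4) \<Longrightarrow> [n = 1 + 3 + 1] (mod 4)" "[n = 2] (mod 4) \<Longrightarrow> [n = 1 + 0 + 1] (mod 4)"
    "[n = 2] (mod 4) \<Longrightarrow> [n = 2 + 3 + 1] (mod 4)" "[n = 3] (mod 4) \<Longrightarrow> [n = 2 + 0 + 1] (mod 4)"
    "[n = 0] (mod 4) \<Longrightarrow> [n = 1 + 2 + 1] (mod 4)" "[n = 0] (mod 4) \<Longrightarrow> [n = 3 + 0 + 1] (mod 4)"
    by (simp_all add: cong_def)
  then show ?thesis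
    unfolding O_eq_weight_class[OF assms] O_0_def orbits_eq_weight_classes[OF assms]
    using reflect[of 1 3] reflect[of 1 0] reflect[of 2 3] reflect[of 2 0] reflect[of 1 2] reflect[of 3 0]
    by blast
qed

end
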